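(* As formal power series in $z$, $$F(312,123;q,z)=1+\left(\frac{z}{1-z}\right)^2+zF(231,123;q,z).$$
   Context: $S_n$ is the set of permutations of $[n]=\{1,\ldots,n\}$ (with $S_0$ consisting of the empty permutation, which has no crossing). A permutation $\sigma\in S_n$ avoids a pattern $\tau\in S_m$ if no subsequence $\sigma(i_1)\cdots\sigma(i_m)$ with $i_1<\cdots<i_m$ is in the same relative order as $\tau$; $S_n(\tau_1,\tau_2)$ is the set of $\sigma\in S_n$ avoiding both $\tau_1$ and $\tau_2$. A crossing of $\sigma$ is a pair $(i,j)$ with $i<j<\sigma(i)<\sigma(j)$ or $\sigma(i)<\sigma(j)\leq i<j$; $\mathrm{cr}(\sigma)$ is the number of crossings. Put $$F(\tau_1,\tau_2;q,z)=\sum_{n\geq 0}\Big(\sum_{\sigma\in S_n(\tau_1,\tau_2)}q^{\mathrm{cr}(\sigma)}\Big)z^n.$$ *)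

theory Defs
  imports "HOL-Combinatorics.Permutations"
    "HOL-Computational_Algebra.Polynomial"
    "HOL-Computational_Algebra.Formal_Power_Series"
begin

(* Permutations of [n] are functions sigma on nat with sigma permutes {1..n}.  A pattern is
   given by its one-line notation as a list (so tau ! a is the paper's tau(a+1)). *)

definition contains_pattern :: "nat \<Rightarrow> (nat \<Rightarrow> nat) \<Rightarrow> nat list \<Rightarrow> bool" where
  "contains_pattern n \<sigma> \<tau> \<longleftrightarrow>
     (\<exists>is. length is = length \<tau> \<and> set is \<subseteq> {1..n} \<and> sorted_wrt (<) is \<and>
        (\<forall>a<length \<tau>. \<forall>b<length \<tau>. \<sigma> (is ! a) < \<sigma> (is ! b) \<longleftrightarrow> \<tau> ! a < \<tau> ! b))"

definition avoiders :: "nat list \<Rightarrow> nat list \<Rightarrow> nat \<Rightarrow> (nat \<Rightarrow> nat) set" where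
  "avoiders \<tau>\<^sub>1 \<tau>\<^sub>2 n =
     {\<sigma>. \<sigma> permutes {1..n} \<and> \<not> contains_pattern n \<sigma> \<tau>\<^sub>1 \<and> \<not> contains_pattern n \<sigma> \<tau>\<^sub>2}"

definition crossings :: "nat \<Rightarrow> (nat \<Rightarrow> nat) \<Rightarrow> (nat \<times> nat) set" where
  "crossings n \<sigma> =
     {(i, j). i \<in> {1..n} \<and> j \<in> {1..n} \<and>
        (i < j \<and> j < \<sigma> i \<and> \<sigma> i < \<sigma> j \<or> \<sigma> i < \<sigma> j \<and> \<sigma> j \<le> i \<and> i < j)}"

definition cr :: "nat \<Rightarrow> (nat \<Rightarrow> nat) \<Rightarrow> nat" where
  "cr n \<sigma> = card (crossings n \<sigma>)"

(* The indeterminate q is the polynomial variable monom 1 1; the series variable z is fps_X. *)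

definition F :: "nat list \<Rightarrow> nat list \<Rightarrow> int poly fps" where
  "F \<tau>\<^sub>1 \<tau>\<^sub>2 = Abs_fps (\<lambda>n. \<Sum>\<sigma>\<in>avoiders \<tau>\<^sub>1 \<tau>\<^sub>2 n. monom 1 1 ^ cr n \<sigma>)"

(* The coefficient ring int poly is not a field, so the library's division of power series is
   unavailable; fps_right_inverse f y is the multiplicative inverse of f whenever y is the
   inverse of its constant coefficient. *)

definition inverse_one_minus_z :: "int poly fps" where
  "inverse_one_minus_z = fps_right_inverse (1 - fps_X) 1"

lemma inverse_one_minus_z: "(1 - fps_X) * inverse_one_minus_z = 1"
  unfolding inverse_one_minus_z_def by (rule fps_right_inverse) simp

end

(* Let k be the position of the value 1 in a permutation of [n] avoiding 312 and 123.  Every entry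
   before it is smaller than every entry after it, and the entries after it decrease.  If k < n,
   then the entries up to the value 1 decrease as well, since a larger entry follows them; this leaves
   only k ... 1 n ... (k+1), a permutation without crossings, and there are n - 1 choices of k.  If k = n,
   removing the final 1 leaves a permutation of [n-1] avoiding 312 and 123, and the crossings of
   the original correspond to those of the inverse of what is left: the shift of the values by one
   turns the strict and the weak inequality in the definition of a crossing into each other. *)

theory Submission
  imports Defs
begin

section \<open>Patterns of length three as chains of inequalities\<close>

lemma contains_pattern_length_3:
  "contains_pattern n \<sigma> [x, y, z] \<longleftrightarrow>
     (\<exists>i j k. 1 \<le> i \<and> i < j \<and> j < k \<and> k \<le> n \<and>
        (\<forall>a<3. \<forall>b<3. \<sigma> ([i, j, k] ! a) < \<sigma> ([i, j, k] ! b) \<longleftrightarrow> [x, y, z] ! a < [x, y, z] ! b))"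
  (is "?L \<longleftrightarrow> ?R")
proof
  assume ?L
  moreover have "length [x, y, z] = 3" by simp
  ultimately obtain "is" where is_props: "length is = 3" "set is \<subseteq> {1..n}" "sorted_wrt (<) is"
    "\<forall>a<3. \<forall>b<3. \<sigma> (is ! a) < \<sigma> (is ! b) \<longleftrightarrow> [x, y, z] ! a < [x, y, z] ! b"
    unfolding contains_pattern_def by metis
  obtain i j k where "is = [i, j, k]"
    using is_props(1) by (auto simp: numeral_3_eq_3 length_Suc_conv)
  with is_props show ?R
    by (intro exI[of _ i] exI[of _ j] exI[of _ k]) simp
next
  assume ?R
  then obtain i j k where "1 \<le> i" "i < j" "j < k" "k \<le> n"
    "\<forall>a<3. \<forall>b<3. \<sigma> ([i, j, k] ! a) < \<sigma> ([i, j, k] ! b) \<longleftrightarrow> [x, y, z] ! a < [x, y, z] ! b"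
    by blast
  then show ?L
    unfolding contains_pattern_def by (intro exI[of _ "[i, j, k]"]) simp
qed

lemma all_less_3: "(\<forall>a<3. P a) \<longleftrightarrow> P 0 \<and> P (Suc 0) \<and> P (2::nat)"
  by (auto simp: numeral_3_eq_3 numeral_2_eq_2 less_Suc_eq)

lemma contains_312_iff:
  "contains_pattern n \<sigma> [3, 1, 2] \<longleftrightarrow>
     (\<exists>i j k. 1 \<le> i \<and> i < j \<and> j < k \<and> k \<le> n \<and> \<sigma> j < \<sigma> k \<and> \<sigma> k < \<sigma> i)"
  unfolding contains_pattern_length_3 all_less_3
  by (intro ex_cong1) auto

lemma contains_231_iff:
  "contains_pattern n \<sigma> [2, 3, 1] \<longleftrightarrow>
     (\<exists>i j k. 1 \<le> i \<and> i < j \<and> j < k \<and> k \<le> n \<and> \<sigma> k < \<sigma> i \<and> \<sigma> i < \<sigma> j)"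
  unfolding contains_pattern_length_3 all_less_3
  by (intro ex_cong1) auto

lemma contains_123_iff:
  "contains_pattern n \<sigma> [1, 2, 3] \<longleftrightarrow>
     (\<exists>i j k. 1 \<le> i \<and> i < j \<and> j < k \<and> k \<le> n \<and> \<sigma> i < \<sigma> j \<and> \<sigma> j < \<sigma> k)"
  unfolding contains_pattern_length_3 all_less_3
  by (intro ex_cong1) auto

lemma finite_avoiders: "finite (avoiders \<tau>\<^sub>1 \<tau>\<^sub>2 n)"
  by (rule finite_subset[of _ "{\<sigma>. \<sigma> permutes {1..n}}"])
     (auto simp: avoiders_def finite_permutations)


subsection \<open>Permutations ending in 1\<close>

definition rot :: "nat \<Rightarrow> nat \<Rightarrow> nat" where
  "rot m i = (if i \<in> {1..m} then Suc i else if i = Suc m then 1 else i)"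

lemma rot_permutes: "rot m permutes {1..Suc m}"
proof (rule bij_imp_permutes)
  show "bij_betw (rot m) {1..Suc m} {1..Suc m}"
    by (rule bij_betw_byWitness[where f' = "\<lambda>i. if i = 1 then Suc m else i - 1"])
       (auto simp: rot_def)
qed (auto simp: rot_def)

lemma rot_less_iff: "a \<in> {1..m} \<Longrightarrow> b \<in> {1..m} \<Longrightarrow> rot m a < rot m b \<longleftrightarrow> a < b"
  by (auto simp: rot_def)

text \<open>In one-line notation: the inverse of \<tau> with every value raised by one, followed by
  1. Building the inverse in lets patterns and crossings of the result be read off from \<tau>
  directly.\<close>

definition append_one :: "nat \<Rightarrow> (nat \<Rightarrow> nat) \<Rightarrow> nat \<Rightarrow> nat" where
  "append_one m \<tau> = rot m \<circ> inv \<tau>"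

context
  fixes m :: nat and \<tau> :: "nat \<Rightarrow> nat"
  assumes \<tau>: "\<tau> permutes {1..m}"
begin

lemma append_one_permutes: "append_one m \<tau> permutes {1..Suc m}"
  unfolding append_one_def
  by (intro permutes_compose rot_permutes permutes_subset[OF permutes_inv[OF \<tau>]]) auto

lemma append_one_last: "append_one m \<tau> (Suc m) = 1"
  using permutes_not_in[OF permutes_inv[OF \<tau>], of "Suc m"]
  by (simp add: append_one_def rot_def)

lemma append_one_apply: "a \<in> {1..m} \<Longrightarrow> append_one m \<tau> (\<tau> a) = Suc a"
  using permutes_inverses(2)[OF \<tau>] by (simp add: append_one_def rot_def)

text \<open>Writing a position other than the last as \<open>\<tau> a\<close> makes the entry there
  equal to \<open>Suc a\<close>, so positions and values trade places.\<close>

lemma obtain_preimage: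
  assumes "1 \<le> i" "i < Suc m"
  obtains a where "a \<in> {1..m}" "i = \<tau> a"
  using assms permutes_image[OF \<tau>] by (metis atLeastAtMost_iff imageE less_Suc_eq_le)

lemma append_one_pos:
  assumes "1 \<le> i" "i < Suc m"
  shows "1 < append_one m \<tau> i"
proof -
  obtain a where "a \<in> {1..m}" "i = \<tau> a" using obtain_preimage[OF assms] .
  then show ?thesis by (simp add: append_one_apply)
qed

lemma in_range: "a \<in> {1..m} \<Longrightarrow> \<tau> a \<in> {1..m}"
  using permutes_in_image[OF \<tau>] by simp

text \<open>The final 1 is the smallest entry, while 312 does not end in its smallest letter, so an
  occurrence lies among the first \<open>m\<close> positions. There inversion turns 312 into its
  inverse pattern 231.\<close>

lemma append_one_contains_312_iff:
  "contains_pattern (Suc m) (append_one m \<tau>) [3, 1, 2] \<longleftrightarrow> contains_pattern m \<tau> [2, 3, 1]"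
proof
  assume "contains_pattern (Suc m) (append_one m \<tau>) [3, 1, 2]"
  then obtain i j k where ijk: "1 \<le> i" "i < j" "j < k" "k \<le> Suc m"
    and less: "append_one m \<tau> j < append_one m \<tau> k" "append_one m \<tau> k < append_one m \<tau> i"
    unfolding contains_312_iff by blast
  have "k \<noteq> Suc m" using append_one_last append_one_pos[of j] ijk less by auto
  with ijk have "k < Suc m" by simp
  obtain a where a: "a \<in> {1..m}" "i = \<tau> a" by (rule obtain_preimage[of i]) (use ijk in auto)
  obtain b where b: "b \<in> {1..m}" "j = \<tau> b" by (rule obtain_preimage[of j]) (use ijk in auto)
  obtain c where c: "c \<in> {1..m}" "k = \<tau> c"
    by (rule obtain_preimage[of k]) (use ijk \<open>k < Suc m\<close> in auto)
  \<comment> \<open>The entries at \<open>i\<close>, \<open>j\<close>, \<open>k\<close> are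
    \<open>Suc a\<close>, \<open>Suc b\<close>, \<open>Suc c\<close>, so \<open>b < c < a\<close>;
    at these places \<tau> takes the values \<open>j\<close>, \<open>k\<close>,
    \<open>i\<close>.\<close>
  show "contains_pattern m \<tau> [2, 3, 1]"
    unfolding contains_231_iff
    by (intro exI[of _ b] exI[of _ c] exI[of _ a])
       (use ijk less a b c append_one_apply in auto)
next
  assume "contains_pattern m \<tau> [2, 3, 1]"
  then obtain b c a where abc: "1 \<le> b" "b < c" "c < a" "a \<le> m" "\<tau> a < \<tau> b" "\<tau> b < \<tau> c"
    unfolding contains_231_iff by blast
  then show "contains_pattern (Suc m) (append_one m \<tau>) [3, 1, 2]"
    unfolding contains_312_iff
    using in_range[of a] in_range[of b] in_range[of c]
    by (intro exI[of _ "\<tau> a"] exI[of _ "\<tau> b"] exI[of _ "\<tau> c"]) (auto simp: append_one_apply)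
qed

text \<open>As for 312: 123 does not end in its smallest letter, and it is its own inverse.\<close>

lemma append_one_contains_123_iff:
  "contains_pattern (Suc m) (append_one m \<tau>) [1, 2, 3] \<longleftrightarrow> contains_pattern m \<tau> [1, 2, 3]"
proof
  assume "contains_pattern (Suc m) (append_one m \<tau>) [1, 2, 3]"
  then obtain i j k where ijk: "1 \<le> i" "i < j" "j < k" "k \<le> Suc m"
    and less: "append_one m \<tau> i < append_one m \<tau> j" "append_one m \<tau> j < append_one m \<tau> k"
    unfolding contains_123_iff by blast
  have "k \<noteq> Suc m" using append_one_last append_one_pos[of j] ijk less by auto
  with ijk have "k < Suc m" by simp
  obtain a where a: "a \<in> {1..m}" "i = \<tau> a" by (rule obtain_preimage[of i]) (use ijk in auto)
  obtain b where b: "b \<in> {1..m}" "j = \<tau> b" by (rule obtain_preimage[of j]) (use ijk in auto)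
  obtain c where c: "c \<in> {1..m}" "k = \<tau> c"
    by (rule obtain_preimage[of k]) (use ijk \<open>k < Suc m\<close> in auto)
  show "contains_pattern m \<tau> [1, 2, 3]"
    unfolding contains_123_iff
    by (intro exI[of _ a] exI[of _ b] exI[of _ c])
       (use ijk less a b c append_one_apply in auto)
next
  assume "contains_pattern m \<tau> [1, 2, 3]"
  then obtain a b c where abc: "1 \<le> a" "a < b" "b < c" "c \<le> m" "\<tau> a < \<tau> b" "\<tau> b < \<tau> c"
    unfolding contains_123_iff by blast
  then show "contains_pattern (Suc m) (append_one m \<tau>) [1, 2, 3]"
    unfolding contains_123_iff
    using in_range[of a] in_range[of b] in_range[of c]
    by (intro exI[of _ "\<tau> a"] exI[of _ "\<tau> b"] exI[of _ "\<tau> c"]) (auto simp: append_one_apply)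
qed

text \<open>With \<open>i = \<tau> a\<close> and \<open>j = \<tau> b\<close>, the condition
  \<open>i < j < Suc a < Suc b\<close> says \<open>\<tau> a < \<tau> b \<le> a < b\<close>, and
  \<open>Suc a < Suc b \<le> i < j\<close> says \<open>a < b < \<tau> a < \<tau> b\<close>. So the
  two kinds of crossing are exchanged.\<close>

lemma crossings_append_one:
  "crossings (Suc m) (append_one m \<tau>) = map_prod \<tau> \<tau> ` crossings m \<tau>"
proof (intro equalityI subsetI)
  fix p assume "p \<in> crossings (Suc m) (append_one m \<tau>)"
  then obtain i j where p: "p = (i, j)" and ij: "(i, j) \<in> crossings (Suc m) (append_one m \<tau>)"
    by (cases p) auto
  have less: "1 \<le> i" "i < j" "j \<le> Suc m" "append_one m \<tau> i < append_one m \<tau> j"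
    using ij by (auto simp: crossings_def)
  \<comment> \<open>Both kinds of crossing need a smaller entry at \<open>i\<close> than at
    \<open>j\<close>, which the final 1 rules out.\<close>
  have "j \<noteq> Suc m" using append_one_last append_one_pos[of i] less by auto
  then have "j < Suc m" using less by simp
  obtain a where a: "a \<in> {1..m}" "i = \<tau> a" by (rule obtain_preimage[of i]) (use less in auto)
  obtain b where b: "b \<in> {1..m}" "j = \<tau> b"
    by (rule obtain_preimage[of j]) (use less \<open>j < Suc m\<close> in auto)
  have "(a, b) \<in> crossings m \<tau>"
    using ij a b by (auto simp: crossings_def append_one_apply)
  then show "p \<in> map_prod \<tau> \<tau> ` crossings m \<tau>"
    using p a b by (intro image_eqI[of _ _ "(a, b)"]) auto
next
  fix p assume "p \<in> map_prod \<tau> \<tau> ` crossings m \<tau>"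
  then obtain a b where p: "p = (\<tau> a, \<tau> b)" and ab: "(a, b) \<in> crossings m \<tau>"
    by auto
  have "a \<in> {1..m}" "b \<in> {1..m}" using ab by (auto simp: crossings_def)
  then show "p \<in> crossings (Suc m) (append_one m \<tau>)"
    using ab p in_range[of a] in_range[of b] append_one_apply[of a] append_one_apply[of b]
    by (auto simp: crossings_def)
qed

lemma cr_append_one: "cr (Suc m) (append_one m \<tau>) = cr m \<tau>"
proof -
  have "inj (map_prod \<tau> \<tau>)"
    using permutes_inj[OF \<tau>] by (simp add: prod.inj_map)
  then show ?thesis
    unfolding cr_def crossings_append_one by (metis card_image inj_on_subset subset_UNIV)
qed

end

lemma inj_on_append_one: "inj_on (append_one m) {\<tau>. \<tau> permutes {1..m}}"
proof (rule inj_onI)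
  fix \<tau> \<tau>' assume perm: "\<tau> \<in> {\<tau>. \<tau> permutes {1..m}}" "\<tau>' \<in> {\<tau>. \<tau> permutes {1..m}}"
    and eq: "append_one m \<tau> = append_one m \<tau>'"
  have "inv \<tau> = inv \<tau>'"
    using eq permutes_inj[OF rot_permutes[of m]]
    by (auto simp: append_one_def fun_eq_iff inj_eq)
  then show "\<tau> = \<tau>'"
    using perm by (metis mem_Collect_eq permutes_inv_inv)
qed

text \<open>Undoing the cyclic shift of the values leaves a permutation that fixes
  \<open>Suc m\<close>, hence one of \<open>{1..m}\<close>; its inverse is the required
  \<tau>.\<close>

lemma obtain_append_one:
  assumes \<sigma>: "\<sigma> permutes {1..Suc m}" and last: "\<sigma> (Suc m) = 1"
  obtains \<tau> where "\<tau> permutes {1..m}" "\<sigma> = append_one m \<tau>"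
proof -
  define \<rho> where "\<rho> = inv (rot m) \<circ> \<sigma>"
  have \<rho>_Suc: "\<rho> permutes {1..Suc m}"
    unfolding \<rho>_def by (intro permutes_compose \<sigma> permutes_inv rot_permutes)
  have "\<rho> (Suc m) = Suc m"
    using permutes_inverses(2)[OF rot_permutes, of m "Suc m"] last by (simp add: \<rho>_def rot_def)
  then have \<rho>: "\<rho> permutes {1..m}"
    by (intro permutes_superset[OF \<rho>_Suc]) (auto simp: le_Suc_eq)
  have "\<sigma> = rot m \<circ> \<rho>"
    using permutes_inverses(1)[OF rot_permutes] by (auto simp: \<rho>_def)
  then have "\<sigma> = append_one m (inv \<rho>)"
    using permutes_inv_inv[OF \<rho>] by (simp add: append_one_def)
  with permutes_inv[OF \<rho>] that show ?thesis by blast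
qed

lemma avoiders_ending_in_one:
  "{\<sigma> \<in> avoiders [3, 1, 2] [1, 2, 3] (Suc m). \<sigma> (Suc m) = 1}
     = append_one m ` avoiders [2, 3, 1] [1, 2, 3] m" (is "?L = ?R")
proof (intro equalityI subsetI)
  fix \<sigma> assume \<sigma>: "\<sigma> \<in> ?L"
  then obtain \<tau> where "\<tau> permutes {1..m}" "\<sigma> = append_one m \<tau>"
    using obtain_append_one[of \<sigma> m] by (auto simp: avoiders_def)
  with \<sigma> show "\<sigma> \<in> ?R"
    by (auto simp: avoiders_def append_one_contains_312_iff append_one_contains_123_iff
             simp del: One_nat_def)
next
  fix \<sigma> assume "\<sigma> \<in> ?R"
  then show "\<sigma> \<in> ?L"
    using append_one_permutes append_one_last
    by (auto simp: avoiders_def append_one_contains_312_iff append_one_contains_123_iff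
             simp del: One_nat_def)
qed


subsection \<open>Permutations not ending in 1\<close>

text \<open>For \<open>k < n\<close>, the one-line notation is k ... 1 n ... (k+1), the direct sum
  of two decreasing permutations.\<close>

definition layered :: "nat \<Rightarrow> nat \<Rightarrow> nat \<Rightarrow> nat" where
  "layered n k i = (if i \<in> {1..k} then Suc k - i else if i \<in> {k<..n} then Suc n + k - i else i)"

lemma layered_permutes:
  assumes "k < n"
  shows "layered n k permutes {1..n}"
proof -
  have invol: "layered n k (layered n k i) = i" for i
    using assms by (auto simp: layered_def)
  show ?thesis
    unfolding permutes_def
  proof (intro conjI allI impI)
    fix i assume "i \<notin> {1..n}"
    then show "layered n k i = i" using assms by (auto simp: layered_def)
  next
    fix j show "\<exists>!i. layered n k i = j" using invol by metis
  qed
qed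

lemma layered_avoids:
  assumes "1 \<le> k" "k < n"
  shows "layered n k \<in> avoiders [3, 1, 2] [1, 2, 3] n"
proof -
  \<comment> \<open>Ascending pairs are exactly those straddling \<open>k\<close>. In 123 two
    successive pairs would straddle it; in 312 the ascent from \<open>j\<close> to \<open>l\<close>
    forces one from \<open>i\<close> to \<open>l\<close>.\<close>
  have less_iff: "layered n k i < layered n k j \<longleftrightarrow> i \<le> k \<and> k < j"
    if "1 \<le> i" "i < j" "j \<le> n" for i j
    using that assms by (auto simp: layered_def)
  have "\<not> contains_pattern n (layered n k) [3, 1, 2]"
  proof
    assume "contains_pattern n (layered n k) [3, 1, 2]"
    then obtain i j l where "1 \<le> i" "i < j" "j < l" "l \<le> n"
      "layered n k j < layered n k l" "layered n k l < layered n k i"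
      unfolding contains_312_iff by blast
    then show False using less_iff[of j l] less_iff[of i l] by auto
  qed
  moreover have "\<not> contains_pattern n (layered n k) [1, 2, 3]"
  proof
    assume "contains_pattern n (layered n k) [1, 2, 3]"
    then obtain i j l where "1 \<le> i" "i < j" "j < l" "l \<le> n"
      "layered n k i < layered n k j" "layered n k j < layered n k l"
      unfolding contains_123_iff by blast
    then show False using less_iff[of i j] less_iff[of j l] by auto
  qed
  ultimately show ?thesis
    using layered_permutes[OF assms(2)] by (simp add: avoiders_def)
qed

text \<open>A crossing is an ascending pair, so \<open>i \<le> k < j\<close>. The entry at
  \<open>i\<close> is then at most \<open>k\<close>, hence below \<open>j\<close>, and the entry at
  \<open>j\<close> exceeds \<open>k\<close>, hence exceeds \<open>i\<close>; this excludes both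
  kinds.\<close>

lemma cr_layered:
  assumes "k < n"
  shows "cr n (layered n k) = 0"
proof -
  have "crossings n (layered n k) = {}"
    using assms by (auto simp: crossings_def layered_def split: if_splits)
  then show ?thesis by (simp add: cr_def)
qed

lemma decreasing_gap:
  fixes \<sigma> :: "nat \<Rightarrow> nat"
  assumes dec: "\<And>i j. a \<le> i \<Longrightarrow> i < j \<Longrightarrow> j \<le> b \<Longrightarrow> \<sigma> j < \<sigma> i"
    and "a \<le> i" "i \<le> j" "j \<le> b"
  shows "\<sigma> j + (j - i) \<le> \<sigma> i"
  using \<open>i \<le> j\<close> \<open>j \<le> b\<close>
proof (induction j rule: dec_induct)
  case (step j)
  have "\<sigma> (Suc j) < \<sigma> j" using step \<open>a \<le> i\<close> by (intro dec) auto
  with step show ?case by simp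
qed simp

text \<open>Avoidance gives only the relative order of the entries; the exact values follow because
  a strictly decreasing run loses at least one per step and its two ends are bounded
  tightly.\<close>

lemma avoider_eq_layered:
  assumes \<sigma>: "\<sigma> \<in> avoiders [3, 1, 2] [1, 2, 3] n" and k: "1 \<le> k" "k < n" "\<sigma> k = 1"
  shows "\<sigma> = layered n k"
proof -
  have perm: "\<sigma> permutes {1..n}"
    and no_312: "\<And>i j l. 1 \<le> i \<Longrightarrow> i < j \<Longrightarrow> j < l \<Longrightarrow> l \<le> n \<Longrightarrow> \<sigma> j < \<sigma> l \<Longrightarrow> \<not> \<sigma> l < \<sigma> i"
    and no_123: "\<And>i j l. 1 \<le> i \<Longrightarrow> i < j \<Longrightarrow> j < l \<Longrightarrow> l \<le> n \<Longrightarrow> \<sigma> i < \<sigma> j \<Longrightarrow> \<not> \<sigma> j < \<sigma> l"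
    using \<sigma> unfolding avoiders_def contains_312_iff contains_123_iff by blast+
  have neq: "\<sigma> i \<noteq> \<sigma> j" if "i < j" for i j
    using permutes_inj[OF perm] that by (auto dest: injD)
  have range: "1 \<le> \<sigma> i" "\<sigma> i \<le> n" if "1 \<le> i" "i \<le> n" for i
    using permutes_in_image[OF perm, of i] that by auto
  have pos: "1 < \<sigma> i" if "1 \<le> i" "i \<le> n" "i \<noteq> k" for i
    using range(1)[of i] neq[of i k] neq[of k i] that k by (cases i k rule: linorder_cases) auto
  \<comment> \<open>Otherwise \<open>\<sigma> i\<close>, 1, \<open>\<sigma> j\<close> form a
    312.\<close>
  have across: "\<sigma> i < \<sigma> j" if "1 \<le> i" "i \<le> k" "k < j" "j \<le> n" for i j
  proof (cases "i = k")
    case False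
    then show ?thesis
      using no_312[of i k j] pos[of j] neq[of i j] that k by auto
  qed (use pos[of j] that k in auto)
  \<comment> \<open>An ascent here would form a 123 with the value 1 at \<open>k\<close>.\<close>
  have dec_right: "\<sigma> j < \<sigma> i" if "Suc k \<le> i" "i < j" "j \<le> n" for i j
    using no_123[of k i j] pos[of i] neq[of i j] that k by auto
  \<comment> \<open>The entry at position \<open>n\<close> exceeds all entries up to
    \<open>k\<close>, so it would complete an ascent to a 123; this needs
    \<open>k < n\<close>.\<close>
  have dec_left: "\<sigma> j < \<sigma> i" if "1 \<le> i" "i < j" "j \<le> k" for i j
    using no_123[of i j n] across[of j n] neq[of i j] that k by (cases "\<sigma> i < \<sigma> j") auto
  have gap_left: "\<sigma> j + (j - i) \<le> \<sigma> i" if "1 \<le> i" "i \<le> j" "j \<le> k" for i j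
    by (rule decreasing_gap[of 1 k \<sigma>]) (use dec_left that in auto)
  have gap_right: "\<sigma> j + (j - i) \<le> \<sigma> i" if "Suc k \<le> i" "i \<le> j" "j \<le> n" for i j
    by (rule decreasing_gap[of "Suc k" n \<sigma>]) (use dec_right that in auto)
  have right: "\<sigma> j = Suc n + k - j" if "k < j" "j \<le> n" for j
  proof -
    have "\<sigma> j + (j - Suc k) \<le> n"
      using gap_right[of "Suc k" j] range(2)[of "Suc k"] that by auto
    \<comment> \<open>The decrease from position 1 to the value 1 at \<open>k\<close> gives
      \<open>k \<le> \<sigma> 1\<close>, and \<open>\<sigma> 1 < \<sigma> n\<close>.\<close>
    moreover have "k < \<sigma> n"
      using gap_left[of 1 k] across[of 1 n] k by auto
    moreover have "\<sigma> n + (n - j) \<le> \<sigma> j"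
      using gap_right[of j n] that by auto
    ultimately show ?thesis using that by auto
  qed
  have left: "\<sigma> i = Suc k - i" if "1 \<le> i" "i \<le> k" for i
  proof -
    \<comment> \<open>The part on the right already gives \<open>\<sigma> n = Suc k\<close>.\<close>
    have "\<sigma> 1 \<le> k" using across[of 1 n] right[of n] k by auto
    then show ?thesis
      using gap_left[of 1 i] gap_left[of i k] that k by auto
  qed
  show ?thesis
  proof
    fix i show "\<sigma> i = layered n k i"
      using left[of i] right[of i] permutes_not_in[OF perm, of i] k by (auto simp: layered_def)
  qed
qed

lemma avoiders_not_ending_in_one:
  "{\<sigma> \<in> avoiders [3, 1, 2] [1, 2, 3] (Suc m). \<sigma> (Suc m) \<noteq> 1} = layered (Suc m) ` {1..m}"
  (is "?L = ?R")
proof (intro equalityI subsetI)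
  fix \<sigma> assume \<sigma>: "\<sigma> \<in> ?L"
  then have "\<sigma> permutes {1..Suc m}" by (simp add: avoiders_def)
  then obtain k where k: "k \<in> {1..Suc m}" "\<sigma> k = 1"
    by (metis atLeastAtMost_iff imageE le_add1 order_refl permutes_image plus_1_eq_Suc)
  with \<sigma> have "k \<noteq> Suc m" by auto
  with k have "k \<in> {1..m}" by auto
  moreover have "\<sigma> = layered (Suc m) k"
    using \<sigma> k \<open>k \<in> {1..m}\<close> by (intro avoider_eq_layered) auto
  ultimately show "\<sigma> \<in> ?R" by blast
next
  fix \<sigma> assume "\<sigma> \<in> ?R"
  then show "\<sigma> \<in> ?L"
    using layered_avoids[where n = "Suc m"] by (auto simp: layered_def)
qed

lemma inj_on_layered: "inj_on (layered n) {1..m}"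
proof (rule inj_onI)
  fix k k' assume "k \<in> {1..m}" "k' \<in> {1..m}" "layered n k = layered n k'"
  \<comment> \<open>The first entry of \<open>layered n k\<close> is \<open>k\<close>.\<close>
  then show "k = k'"
    by (auto simp: layered_def dest!: fun_cong[where x = 1])
qed


subsection \<open>Generating functions\<close>

text \<open>The coefficient form of the theorem: the \<open>m\<close> layered permutations
  contribute 1 each, and those ending in 1 contribute the 231 sum for \<open>m\<close>.\<close>

lemma sum_avoiders_Suc:
  "(\<Sum>\<sigma>\<in>avoiders [3, 1, 2] [1, 2, 3] (Suc m). (x :: 'a :: comm_semiring_1) ^ cr (Suc m) \<sigma>)
     = of_nat m + (\<Sum>\<tau>\<in>avoiders [2, 3, 1] [1, 2, 3] m. x ^ cr m \<tau>)"
proof -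
  let ?A = "avoiders [3, 1, 2] [1, 2, 3] (Suc m)" and ?B = "avoiders [2, 3, 1] [1, 2, 3] m"
  let ?f = "\<lambda>\<sigma>. x ^ cr (Suc m) \<sigma>"
  have inj: "inj_on (append_one m) ?B"
    by (rule inj_on_subset[OF inj_on_append_one]) (auto simp: avoiders_def)
  have "sum ?f ?A = sum ?f ({\<sigma>\<in>?A. \<sigma> (Suc m) \<noteq> 1} \<union> {\<sigma>\<in>?A. \<sigma> (Suc m) = 1})"
    by (rule sum.cong) auto
  also have "\<dots> = sum ?f {\<sigma>\<in>?A. \<sigma> (Suc m) \<noteq> 1} + sum ?f {\<sigma>\<in>?A. \<sigma> (Suc m) = 1}"
    by (rule sum.union_disjoint) (auto simp: finite_avoiders)
  also have "sum ?f {\<sigma>\<in>?A. \<sigma> (Suc m) \<noteq> 1} = (\<Sum>k\<in>{1..m}. ?f (layered (Suc m) k))"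
    unfolding avoiders_not_ending_in_one by (simp only: sum.reindex[OF inj_on_layered] o_def)
  also have "\<dots> = of_nat m"
    by (simp add: cr_layered)
  also have "sum ?f {\<sigma>\<in>?A. \<sigma> (Suc m) = 1} = (\<Sum>\<tau>\<in>?B. ?f (append_one m \<tau>))"
    unfolding avoiders_ending_in_one by (simp only: sum.reindex[OF inj] o_def)
  also have "\<dots> = (\<Sum>\<tau>\<in>?B. x ^ cr m \<tau>)"
    by (rule sum.cong) (auto simp: avoiders_def cr_append_one)
  finally show ?thesis .
qed

lemma sum_avoiders_0:
  "(\<Sum>\<sigma>\<in>avoiders [3, 1, 2] [1, 2, 3] 0. (x :: 'a :: comm_semiring_1) ^ cr 0 \<sigma>) = 1"
proof -
  have "avoiders [3, 1, 2] [1, 2, 3] 0 = {id}"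
    by (auto simp: avoiders_def contains_pattern_def)
  then show ?thesis by (simp add: cr_def crossings_def)
qed

lemma inverse_one_minus_z_eq: "inverse_one_minus_z = Abs_fps (\<lambda>_. 1)"
proof -
  have "(1 - fps_X) * Abs_fps (\<lambda>_. 1 :: int poly) = 1"
    by (rule fps_ext) (auto simp: left_diff_distrib)
  then have "(1 - fps_X) * inverse_one_minus_z = (1 - fps_X) * Abs_fps (\<lambda>_. 1)"
    by (simp add: inverse_one_minus_z)
  \<comment> \<open>Series over \<open>int poly\<close> form an integral domain, so the nonzero
    factor cancels.\<close>
  moreover have "(1 - fps_X :: int poly fps) \<noteq> 0"
    using inverse_one_minus_z by force
  ultimately show ?thesis by simp
qed

text \<open>The square of the geometric series has coefficients \<open>l + 1\<close>, and the factor
  \<open>fps_X ^ 2\<close> shifts them by two. Truncated subtraction gives the correct value 0 at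
  \<open>n = 0\<close>.\<close>

lemma fps_nth_z_over_one_minus_z_squared:
  "fps_nth ((fps_X * inverse_one_minus_z)\<^sup>2) n = of_nat (n - 1)"
proof -
  have "(fps_X * inverse_one_minus_z)\<^sup>2 = fps_X ^ 2 * (inverse_one_minus_z * inverse_one_minus_z)"
    by (simp add: power2_eq_square mult_ac)
  moreover have "fps_nth (inverse_one_minus_z * inverse_one_minus_z) l = of_nat (Suc l)" for l
    by (simp add: fps_mult_nth inverse_one_minus_z_eq)
  ultimately show ?thesis
    by (cases n) (auto simp: fps_X_power_mult_nth not_less Suc_diff_Suc)
qed

theorem mainTheorem4:
  shows "F [3, 1, 2] [1, 2, 3]
       = 1 + (fps_X * inverse_one_minus_z)\<^sup>2 + fps_X * F [2, 3, 1] [1, 2, 3]"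
proof (rule fps_ext)
  fix n
  show "fps_nth (F [3, 1, 2] [1, 2, 3]) n
      = fps_nth (1 + (fps_X * inverse_one_minus_z)\<^sup>2 + fps_X * F [2, 3, 1] [1, 2, 3]) n"
    \<comment> \<open>The summand 1 accounts for the empty permutation at \<open>n = 0\<close>; for
      \<open>n = Suc m\<close> the square supplies the \<open>m\<close> of
      \<open>sum_avoiders_Suc\<close>.\<close>
    by (cases n)
       (simp_all only: F_def fps_add_nth fps_nth_z_over_one_minus_z_squared fps_nth_Abs_fps
          sum_avoiders_0 sum_avoiders_Suc fps_X_mult_nth fps_one_nth,
        simp_all)
qed

end
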